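(* Let $p$ be a prime and let $\nu$ be a positive integer. Let $A$ be a finite abelian group such that $p\nmid |A|$ and let $P$ be a finite abelian $p$-group. Let $r_{I'}$ be the number of $p^{2\nu}$-cyclotomic classes of $A$ of type $I'$ and let $2r_{II'}$ be the number of $p^{2\nu}$-cyclotomic classes of $A$ of type $II'$. Then the number of Hermitian complementary dual abelian codes in $\mathbb{F}_{p^{2\nu}}[A\times P]$ is $2^{r_{I'}+r_{II'}}$.
   Context: For a finite abelian group $G$ (written additively), an abelian code in $\mathbb{F}_{p^{2\nu}}[G]$ is an ideal of this group algebra. For $u=\sum_g u_gY^g$, $v=\sum_g v_gY^g$ the Hermitian inner product is $\langle u,v\rangle_{\rm H}=\sum_g u_gv_g^{p^\nu}$, $C^{\perp_{\rm H}}=\{v : \langle c,v\rangle_{\rm H}=0\ \forall c\in C\}$, and $C$ is Hermitian complementary dual if $C\cap C^{\perp_{\rm H}}=\{0\}$. For $a\in A$, $S_{p^{2\nu}}(a)=\{p^{2\nu i}\cdot a : i\ge 0\}$ is the $p^{2\nu}$-cyclotomic class of $a$ (these classes partition $A$); it is of type $I'$ if $S_{p^{2\nu}}(a)=S_{p^{2\nu}}(-p^\nu a)$ and of type $II'$ otherwise. Classes of type $II'$ come in pairs $S_{p^{2\nu}}(a)\ne S_{p^{2\nu}}(-p^\nu a)$, so their number is even. *)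

theory Defs
  imports
    Complex_Main
    "HOL-Computational_Algebra.Primes"
    "HOL-Library.Poly_Mapping"
    "HOL-Library.Product_Plus"
    "HOL-Library.Cardinality"
begin

text \<open>
  For a finite abelian group given as a type \<open>'g\<close> and a finite field given as a type \<open>'f\<close>, the
  group algebra is the type \<open>'g \<Rightarrow>\<^sub>0 'f\<close> of \<^theory>\<open>HOL-Library.Poly_Mapping\<close>, whose multiplication
  is convolution; \<open>Poly_Mapping.lookup u g\<close> is the coefficient of \<open>Y\<close> to the power \<open>g\<close> in \<open>u\<close>.
\<close>

text \<open>An ideal of a commutative ring is a submodule of the ring regarded as a module over itself.\<close>

definition abelian_code :: "('g::ab_group_add \<Rightarrow>\<^sub>0 'f::field) set \<Rightarrow> bool" where
  "abelian_code C \<longleftrightarrow> module.subspace (*) C"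

lemma module_times: "module ((*) :: 'r::comm_ring_1 \<Rightarrow> 'r \<Rightarrow> 'r)"
  by unfold_locales (simp_all add: algebra_simps)

lemma abelian_code_iff:
  "abelian_code C \<longleftrightarrow>
     0 \<in> C \<and> (\<forall>x\<in>C. \<forall>y\<in>C. x + y \<in> C) \<and> (\<forall>r. \<forall>x\<in>C. r * x \<in> C)"
  unfolding abelian_code_def module.subspace_def[OF module_times] ..

text \<open>In the following, the field is meant to have \<open>p\<close> to the power \<open>2 * \<nu>\<close> elements.\<close>

definition hermitian_inner ::
    "nat \<Rightarrow> nat \<Rightarrow> ('g::finite \<Rightarrow>\<^sub>0 'f::field) \<Rightarrow> ('g \<Rightarrow>\<^sub>0 'f) \<Rightarrow> 'f" where
  "hermitian_inner p \<nu> u v = (\<Sum>g\<in>UNIV. Poly_Mapping.lookup u g * Poly_Mapping.lookup v g ^ (p ^ \<nu>))"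

definition hermitian_dual ::
    "nat \<Rightarrow> nat \<Rightarrow> ('g::finite \<Rightarrow>\<^sub>0 'f::field) set \<Rightarrow> ('g \<Rightarrow>\<^sub>0 'f) set" where
  "hermitian_dual p \<nu> C = {v. \<forall>c\<in>C. hermitian_inner p \<nu> c v = 0}"

definition hermitian_complementary_dual ::
    "nat \<Rightarrow> nat \<Rightarrow> ('g::finite \<Rightarrow>\<^sub>0 'f::field) set \<Rightarrow> bool" where
  "hermitian_complementary_dual p \<nu> C \<longleftrightarrow> C \<inter> hermitian_dual p \<nu> C = {0}"

text \<open>The multiple \<open>n \<cdot> a\<close> in an additive group, as an iterated sum.\<close>

definition nat_multiple :: "nat \<Rightarrow> 'a::ab_group_add \<Rightarrow> 'a" where
  "nat_multiple n a = ((+) a ^^ n) 0"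

definition cyclotomic_class :: "nat \<Rightarrow> 'a::ab_group_add \<Rightarrow> 'a set" where
  "cyclotomic_class q a = {nat_multiple (q ^ i) a | i. True}"

definition type_I' :: "nat \<Rightarrow> nat \<Rightarrow> 'a::ab_group_add \<Rightarrow> bool" where
  "type_I' p \<nu> a \<longleftrightarrow>
     cyclotomic_class (p ^ (2 * \<nu>)) a =
     cyclotomic_class (p ^ (2 * \<nu>)) (- nat_multiple (p ^ \<nu>) a)"

text \<open>The sets of classes themselves, so that their cardinalities count classes, not elements.\<close>

definition classes_type_I' :: "nat \<Rightarrow> nat \<Rightarrow> 'a::ab_group_add set set" where
  "classes_type_I' p \<nu> = {cyclotomic_class (p ^ (2 * \<nu>)) a | a. type_I' p \<nu> a}"

definition classes_type_II' :: "nat \<Rightarrow> nat \<Rightarrow> 'a::ab_group_add set set" where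
  "classes_type_II' p \<nu> = {cyclotomic_class (p ^ (2 * \<nu>)) a | a. \<not> type_I' p \<nu> a}"

end

theory Submission
  imports Defs "HOL-Number_Theory.Residues" "HOL-Computational_Algebra.Polynomial"
begin

text \<open>
  Let \<open>Q = p ^ \<nu>\<close> and let \<open>u \<mapsto> star Q u\<close> be the conjugation that sends \<open>Y\<close> to its inverse and
  raises coefficients to the power \<open>Q\<close>. For an ideal \<open>C\<close> with trivial intersection with its
  Hermitian dual, the Hermitian form is nondegenerate on \<open>C\<close>, so \<open>1\<close> has an orthogonal projection
  \<open>e\<close> to \<open>C\<close>; this \<open>e\<close> is a self-conjugate idempotent that generates \<open>C\<close>, and every
  self-conjugate idempotent arises in this way.

  All these idempotents lie in the ring \<open>T\<close> of elements with \<open>u ^ Q = u = star Q u\<close>, an algebra over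
  the field with \<open>Q\<close> elements in which \<open>u ^ Q = u\<close> holds identically. Hence \<open>T\<close> is a product of
  copies of this field and has \<open>2 ^ t\<close> idempotents, where \<open>Q ^ t\<close> is its cardinality. In terms of
  coefficients, \<open>T\<close> consists of the functions on \<open>A\<close> that are constant on the orbits of
  \<open>a \<mapsto> - Q a\<close> and take conjugate values at \<open>a\<close> and \<open>- a\<close>; so \<open>t\<close> is the number of these orbits. The
  square of \<open>a \<mapsto> - Q a\<close> is multiplication by \<open>Q\<^sup>2\<close>, so such an orbit is either a cyclotomic class of
  type \<open>I'\<close> or the union of a pair of classes of type \<open>II'\<close>.
\<close>

section \<open>Idempotents\<close>

text \<open>Order idempotents by \<open>h * g = h\<close>. Among the nonzero ones below
  \<open>f\<close>, take an \<open>e\<close> with the fewest members of \<open>B\<close> below it; a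
  product \<open>g * e\<close> other than 0 and \<open>e\<close> would have strictly fewer, since
  \<open>e\<close> itself is lost.\<close>

lemma ex_atom_below:
  fixes B :: "'r::comm_ring_1 set"
  assumes fin: "finite B" and idem: "\<And>e. e \<in> B \<Longrightarrow> e * e = e"
    and mult: "\<And>e f. e \<in> B \<Longrightarrow> f \<in> B \<Longrightarrow> e * f \<in> B"
    and f: "f \<in> B" "f \<noteq> 0"
  obtains e where "e \<in> B" "e \<noteq> 0" "e * f = e" "\<And>g. g \<in> B \<Longrightarrow> g * e = 0 \<or> g * e = e"
proof -
  let ?below = "\<lambda>g. {h \<in> B. h * g = h}"
  let ?P = "\<lambda>g. g \<in> B \<and> g \<noteq> 0 \<and> g * f = g"
  have "?P f"
    using f idem by auto
  then obtain e where e: "?P e" and least: "\<And>g. ?P g \<Longrightarrow> card (?below e) \<le> card (?below g)"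
    using ex_has_least_nat[of ?P f "\<lambda>g. card (?below g)"] by blast
  show thesis
  proof
    fix g assume g: "g \<in> B"
    show "g * e = 0 \<or> g * e = e"
    proof (rule ccontr)
      assume *: "\<not> (g * e = 0 \<or> g * e = e)"
      have "?P (g * e)"
        using * e g mult by (simp add: mult.assoc)
      have "?below (g * e) \<subset> ?below e"
      proof
        show "?below (g * e) \<subseteq> ?below e"
        proof safe
          fix h assume h: "h \<in> B" "h * (g * e) = h"
          have "h * e = h * g * (e * e)"
            using h(2) by (metis mult.assoc)
          also have "\<dots> = h"
            using e idem h(2) by (simp add: mult.assoc)
          finally show "h * e = h" .
        qed
        have "e \<notin> ?below (g * e)"
          using * e idem by (simp add: mult.left_commute[of e g e])
        moreover have "e \<in> ?below e"
          using e idem by simp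
        ultimately show "?below (g * e) \<noteq> ?below e"
          by metis
      qed
      then have "card (?below (g * e)) < card (?below e)"
        using fin by (intro psubset_card_mono) auto
      then show False
        using least[OF \<open>?P (g * e)\<close>] by simp
    qed
  qed (use e in auto)
qed

text \<open>
  The ring \<open>T\<close> is a product of copies of \<open>K\<close>, one for each primitive idempotent, so both \<open>T\<close> and
  its set of idempotents are counted by the number of primitive idempotents.
\<close>

lemma card_idempotents:
  fixes T K :: "'r::comm_ring_1 set"
  assumes fin: "finite T" and one: "1 \<in> T"
    and diff: "\<And>x y. x \<in> T \<Longrightarrow> y \<in> T \<Longrightarrow> x - y \<in> T"
    and mult: "\<And>x y. x \<in> T \<Longrightarrow> y \<in> T \<Longrightarrow> x * y \<in> T"
    and pow: "\<And>x. x \<in> T \<Longrightarrow> x ^ q = x"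
    and K: "K \<subseteq> T" "card K = q" "q \<ge> 2"
    and cancel: "\<And>c d e. c \<in> K \<Longrightarrow> d \<in> K \<Longrightarrow> e \<in> T \<Longrightarrow> c * e = d * e \<Longrightarrow> e \<noteq> 0 \<Longrightarrow> c = d"
    and roots: "\<And>x. x \<in> T \<Longrightarrow> (\<Prod>c\<in>K. x - c) = 0"
    and card_T: "card T = q ^ t"
  shows "card {e \<in> T. e * e = e} = 2 ^ t"
proof -
  define B where "B = {e \<in> T. e * e = e}"
  define At where "At = {e \<in> B. e \<noteq> 0 \<and> (\<forall>f\<in>B. f * e = 0 \<or> f * e = e)}"
  have zero: "0 \<in> T"
    using diff[OF one one] by simp
  have add: "x + y \<in> T" if "x \<in> T" "y \<in> T" for x y
    using diff[OF that(1) diff[OF zero that(2)]] by simp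
  have sum: "sum f S \<in> T" if "\<And>x. x \<in> S \<Longrightarrow> f x \<in> T" for f :: "'r \<Rightarrow> 'r" and S
    using that by (induction S rule: infinite_finite_induct) (auto intro: zero add)
  have power: "x ^ n \<in> T" if "x \<in> T" for x n
    using that by (induction n) (auto intro: one mult)
  have finB: "finite B" and finA: "finite At"
    using fin by (auto simp: B_def At_def)
  have AtB: "e \<in> B" "e \<in> T" "e * e = e" "e \<noteq> 0" if "e \<in> At" for e
    using that by (auto simp: At_def B_def)
  have AtD: "f * e = 0 \<or> f * e = e" if "e \<in> At" "f \<in> B" for e f
    using that by (auto simp: At_def)
  have orth: "e * f = 0" if "e \<in> At" "f \<in> At" "e \<noteq> f" for e f
    using AtD[of e f] AtD[of f e] AtB that by (metis mult.commute)
  have B_mult: "e * f \<in> B" if "e \<in> B" "f \<in> B" for e f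
  proof -
    have "e * f * (e * f) = (e * e) * (f * f)"
      by (simp only: ac_simps)
    also have "\<dots> = e * f"
      using that by (simp add: B_def)
    finally show ?thesis
      using that by (simp add: B_def mult)
  qed
  have coeff: "e * (\<Sum>f\<in>S. c f * f) = (if e \<in> S then c e * e else 0)"
    if "e \<in> At" "S \<subseteq> At" for e S and c :: "'r \<Rightarrow> 'r"
  proof -
    have "e * (\<Sum>f\<in>S. c f * f) = (\<Sum>f\<in>S. if f = e then c e * e else 0)"
      unfolding sum_distrib_left
    proof (rule sum.cong[OF refl])
      fix f assume "f \<in> S"
      then show "e * (c f * f) = (if f = e then c e * e else 0)"
        using that orth[of e f] AtB(3)[OF that(1)] by (subst mult.left_commute) auto
    qed
    also have "\<dots> = (if e \<in> S then c e * e else 0)"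
      using finite_subset[OF that(2) finA] by (simp add: sum.delta)
    finally show ?thesis .
  qed
  have coeff1: "e * \<Sum>S = (if e \<in> S then e else 0)" if "e \<in> At" "S \<subseteq> At" for e S
    using coeff[OF that, of "\<lambda>_. 1"] by simp
  have sum_B: "\<Sum>S \<in> B" if "S \<subseteq> At" for S
  proof -
    have "\<Sum>S * \<Sum>S = (\<Sum>e\<in>S. e * \<Sum>S)"
      by (rule sum_distrib_right)
    also have "\<dots> = \<Sum>S"
      using coeff1[OF subsetD[OF that] that] by (intro sum.cong) simp_all
    finally show ?thesis
      using that AtB by (auto simp: B_def intro!: sum)
  qed
  have sum_At: "\<Sum>At = 1"
  proof (rule ccontr)
    let ?s = "\<Sum>At"
    assume "?s \<noteq> 1"
    have "?s \<in> T" "?s * ?s = ?s"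
      using sum_B[of At] by (auto simp: B_def)
    \<comment> \<open>A primitive idempotent \<open>e\<close> below the complement satisfies
      \<open>e * ?s = 0\<close>, yet as a member of \<open>At\<close> it satisfies
      \<open>e * ?s = e\<close>.\<close>
    then have "1 - ?s \<in> B"
      by (simp add: B_def diff one algebra_simps)
    moreover have "1 - ?s \<noteq> 0"
      using \<open>?s \<noteq> 1\<close> by simp
    ultimately obtain e where e: "e \<in> B" "e \<noteq> 0" "e * (1 - ?s) = e" "\<And>g. g \<in> B \<Longrightarrow> g * e = 0 \<or> g * e = e"
      using ex_atom_below[of B "1 - ?s"] finB B_mult unfolding B_def by blast
    then have "e \<in> At"
      by (auto simp: At_def)
    then show False
      using coeff1[of e At] e by (simp add: right_diff_distrib)
  qed
  have decomp: "u = (\<Sum>e\<in>At. e * u)" for u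
    using sum_distrib_right[of "\<lambda>e. e" At u] by (simp add: sum_At)

  \<comment> \<open>An idempotent is the sum of the primitive ones below it.\<close>
  have "bij_betw (\<lambda>S. \<Sum>S) (Pow At) B"
  proof (rule bij_betw_byWitness[where f' = "\<lambda>u. {e \<in> At. e * u = e}"])
    show "\<forall>S\<in>Pow At. {e \<in> At. e * \<Sum>S = e} = S"
    proof
      fix S assume "S \<in> Pow At"
      then have "e * \<Sum>S = e \<longleftrightarrow> e \<in> S" if "e \<in> At" for e
        using coeff1[OF that, of S] AtB(4)[OF that] by auto
      then show "{e \<in> At. e * \<Sum>S = e} = S"
        using \<open>S \<in> Pow At\<close> by blast
    qed
    show "\<forall>u\<in>B. \<Sum>{e \<in> At. e * u = e} = u"
    proof
      fix u assume u: "u \<in> B"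
      have "(\<Sum>e\<in>At. e * u) = \<Sum>{e \<in> At. e * u = e}"
        using finA AtD[OF _ u] by (intro sum.mono_neutral_cong_right) (auto simp: mult.commute)
      then show "\<Sum>{e \<in> At. e * u = e} = u"
        using decomp[of u] by simp
    qed
  qed (use sum_B in auto)
  then have card_B: "card B = 2 ^ card At"
    by (metis bij_betw_same_card card_Pow finA)

  have ex_coeff: "\<exists>c\<in>K. u * e = c * e" if u: "u \<in> T" and e: "e \<in> At" for u e
  proof (rule ccontr)
    assume none: "\<not> (\<exists>c\<in>K. u * e = c * e)"
    \<comment> \<open>Since \<open>?w ^ q = ?w\<close>, the power \<open>?w ^ (q - 1)\<close> is
      idempotent, so it multiplies \<open>e\<close> to 0 or to \<open>e\<close>; the value 0 would
      give \<open>u * e = c * e\<close>.\<close>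
    have *: "(u - c) ^ (q - 1) * e = e" if c: "c \<in> K" for c
    proof -
      let ?w = "u - c"
      have w: "?w \<in> T"
        using K c u diff by auto
      have "?w ^ (q - 1) * ?w ^ (q - 1) = ?w ^ q * ?w ^ (q - 2)"
        using K(3) by (auto simp flip: power_add intro!: arg_cong[of _ _ "\<lambda>n. ?w ^ n"])
      also have "\<dots> = ?w ^ (q - 1)"
        using K(3) by (simp add: pow[OF w] Suc_diff_Suc numeral_2_eq_2 Suc_diff_le flip: power_Suc)
      finally have "?w ^ (q - 1) \<in> B"
        using power[OF w] by (simp add: B_def)
      then consider "?w ^ (q - 1) * e = 0" | "?w ^ (q - 1) * e = e"
        using AtD[OF e] by blast
      then show ?thesis
      proof cases
        case 1
        then have "?w ^ q * e = 0"
          using K(3) by (cases q) (auto simp: mult.assoc)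
        then have "u * e = c * e"
          by (simp add: pow[OF w] left_diff_distrib)
        then show ?thesis
          using none c by blast
      qed
    qed
    \<comment> \<open>Over all of \<open>K\<close> this says that \<open>e\<close> is preserved by a
      power of the product that vanishes by \<open>roots\<close>.\<close>
    have "(\<Prod>c\<in>L. (u - c) ^ (q - 1)) * e = e" if "L \<subseteq> K" for L
      using that by (induction L rule: infinite_finite_induct) (auto simp: *[simplified] mult.assoc)
    from this[of K] have "(\<Prod>c\<in>K. u - c) ^ (q - 1) * e = e"
      by (simp add: prod_power_distrib)
    then show False
      using roots[OF u] AtB(4)[OF e] K(3) by (simp add: power_0_left split: if_splits)
  qed
  \<comment> \<open>Multiplying a combination by \<open>e\<close> isolates its coefficient at
    \<open>e\<close>, so \<open>cancel\<close> gives injectivity; \<open>ex_coeff\<close> gives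
    surjectivity.\<close>
  have "bij_betw (\<lambda>f. \<Sum>e\<in>At. f e * e) (At \<rightarrow>\<^sub>E K) T"
  proof (rule bij_betw_imageI)
    show "inj_on (\<lambda>f. \<Sum>e\<in>At. f e * e) (At \<rightarrow>\<^sub>E K)"
    proof
      fix f g assume fg: "f \<in> At \<rightarrow>\<^sub>E K" "g \<in> At \<rightarrow>\<^sub>E K" "(\<Sum>e\<in>At. f e * e) = (\<Sum>e\<in>At. g e * e)"
      have "f e = g e" if e: "e \<in> At" for e
        using coeff[OF e order_refl, of f] coeff[OF e order_refl, of g] fg cancel[of "f e" "g e" e] AtB e
        by (auto simp: PiE_iff)
      then show "f = g"
        using fg PiE_ext by blast
    qed
    show "(\<lambda>f. \<Sum>e\<in>At. f e * e) ` (At \<rightarrow>\<^sub>E K) = T"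
    proof (intro subset_antisym subsetI)
      fix u assume u: "u \<in> T"
      define f where "f = restrict (\<lambda>e. SOME c. c \<in> K \<and> u * e = c * e) At"
      have f: "f e \<in> K \<and> u * e = f e * e" if "e \<in> At" for e
        using someI_ex[of "\<lambda>c. c \<in> K \<and> u * e = c * e"] ex_coeff[OF u that] that
        unfolding f_def by auto
      then have "f \<in> At \<rightarrow>\<^sub>E K"
        by (auto simp: f_def)
      moreover have "(\<Sum>e\<in>At. f e * e) = u"
        using decomp[of u] f by (simp add: mult.commute)
      ultimately show "u \<in> (\<lambda>f. \<Sum>e\<in>At. f e * e) ` (At \<rightarrow>\<^sub>E K)"
        by blast
    qed (use K AtB in \<open>auto intro!: sum mult simp: PiE_iff\<close>)
  qed
  then have "card T = q ^ card At"
    using card_PiE[OF finA, of "\<lambda>_. K"] K(2) by (simp add: bij_betw_same_card)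
  then show ?thesis
    using card_T card_B K(3) by (simp add: B_def)
qed

section \<open>Orbits\<close>

text \<open>Only forward iterates, in the shape of \<open>cyclotomic_class\<close>; for an injective
  map of a finite type this is the full cycle through \<open>a\<close>.\<close>

definition orb :: "('a \<Rightarrow> 'a) \<Rightarrow> 'a \<Rightarrow> 'a set" where
  "orb f a = {(f ^^ i) a | i. True}"

lemma funpow_in_orb: "(f ^^ i) a \<in> orb f a"
  by (auto simp: orb_def)

lemma self_in_orb: "a \<in> orb f a"
  using funpow_in_orb[of 0] by simp

lemma orb_eqI:
  fixes f :: "'a::finite \<Rightarrow> 'a"
  assumes "inj f" "x \<in> orb f a"
  shows "orb f x = orb f a"
proof -
  have sub: "orb f x \<subseteq> orb f a" if x: "x \<in> orb f a" for x a
  proof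
    fix y assume "y \<in> orb f x"
    then obtain i where "y = (f ^^ i) x"
      by (auto simp: orb_def)
    moreover obtain j where "x = (f ^^ j) a"
      using x by (auto simp: orb_def)
    ultimately have "y = (f ^^ (i + j)) a"
      by (simp add: funpow_add)
    then show "y \<in> orb f a"
      by (simp only: funpow_in_orb)
  qed
  obtain i where i: "x = (f ^^ i) a"
    using assms(2) by (auto simp: orb_def)
  obtain n where n: "n > 0" "(f ^^ n) a = a"
    using funpow_inj_finite[OF assms(1)] finite by blast
  \<comment> \<open>As \<open>n\<close> is a positive period, \<open>n * i\<close> is at least
    \<open>i\<close>, so \<open>n * i - i\<close> further steps lead from \<open>x\<close> back to
    \<open>a\<close>.\<close>
  have "(f ^^ (n * i)) a = a"
    using n(2) by (induction i) (simp_all add: funpow_add)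
  moreover have "n * i = (n * i - i) + i"
    using n(1) by (cases n) auto
  ultimately have "a = (f ^^ (n * i - i)) x"
    unfolding i by (metis comp_apply funpow_add)
  then have "a \<in> orb f x"
    by (metis funpow_in_orb)
  then show ?thesis
    using sub assms(2) by blast
qed

lemma image_orb_commute:
  assumes "\<And>x. g (f x) = f (g x)"
  shows "g ` orb f a = orb f (g a)"
proof -
  have "g ((f ^^ i) a) = (f ^^ i) (g a)" for i
    by (induction i) (auto simp: assms)
  then have "(\<lambda>i. g ((f ^^ i) a)) ` UNIV = (\<lambda>i. (f ^^ i) (g a)) ` UNIV"
    by simp
  then show ?thesis
    by (simp add: orb_def full_SetCompr_eq image_image)
qed

lemma orb_eq_Un: "orb f a = orb (f ^^ 2) a \<union> orb (f ^^ 2) (f a)"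
proof -
  have "(f ^^ i) a \<in> orb (f ^^ 2) a \<union> orb (f ^^ 2) (f a)" for i
  proof (cases "even i")
    case True
    then obtain j where "i = 2 * j" by blast
    then have "(f ^^ i) a = ((f ^^ 2) ^^ j) a"
      by (simp add: funpow_mult)
    then show ?thesis
      by (simp only: funpow_in_orb UnI1)
  next
    case False
    then obtain j where "i = 2 * j + 1" by (auto elim: oddE)
    then have "(f ^^ i) a = ((f ^^ 2) ^^ j) (f a)"
      by (simp add: funpow_mult funpow_swap1)
    then show ?thesis
      by (simp only: funpow_in_orb UnI2)
  qed
  moreover have "((f ^^ 2) ^^ j) a = (f ^^ (2 * j)) a" "((f ^^ 2) ^^ j) (f a) = (f ^^ (2 * j + 1)) a" for j
    by (simp_all add: funpow_mult funpow_swap1)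
  ultimately show ?thesis
    unfolding orb_def by blast
qed

text \<open>An \<open>f\<close>-orbit is either a single orbit of the square of \<open>f\<close> or the union of two of them.\<close>

lemma card_orbs_square:
  fixes f :: "'a::finite \<Rightarrow> 'a"
  assumes "inj f"
  defines "orb2 \<equiv> orb (f ^^ 2)"
  shows "2 * card (range (orb f)) =
    2 * card {orb2 a | a. orb2 a = orb2 (f a)} + card {orb2 a | a. orb2 a \<noteq> orb2 (f a)}"
proof -
  let ?I = "{orb2 a | a. orb2 a = orb2 (f a)}" and ?II = "{orb2 a | a. orb2 a \<noteq> orb2 (f a)}"
  \<comment> \<open>\<open>M\<close> sends an orbit of the square to the \<open>f\<close>-orbit
    containing it.\<close>
  define M where "M S = S \<union> f ` S" for S
  have "inj (f ^^ 2)"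
    using assms by (intro inj_fn)
  then have eq: "orb2 x = orb2 a" if "x \<in> orb2 a" for x a
    using orb_eqI that unfolding orb2_def by metis
  have self: "a \<in> orb2 a" for a
    by (simp add: orb2_def self_in_orb)
  have image: "f ` orb2 a = orb2 (f a)" for a
    unfolding orb2_def by (rule image_orb_commute) (simp add: numeral_2_eq_2)
  have ff: "orb2 (f (f a)) = orb2 a" for a
    using funpow_in_orb[of 1 "f ^^ 2" a] by (intro eq) (simp add: orb2_def numeral_2_eq_2)
  have M: "M (orb2 a) = orb f a" for a
    by (simp only: M_def image) (simp only: orb2_def orb_eq_Un[of f a])
  have M_I: "M S = S" if S: "S \<in> ?I" for S
  proof -
    obtain a where "S = orb2 a" "orb2 a = orb2 (f a)"
      using S by blast
    then have "f ` S = S"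
      using image[of a] by metis
    then show ?thesis
      by (simp add: M_def)
  qed
  have M_eq: "orb2 b = orb2 a \<or> orb2 b = orb2 (f a)" if "M (orb2 a) = M (orb2 b)" for a b
    using that self[of b] eq unfolding M_def image by blast
  have "range (orb f) = M ` ?I \<union> M ` ?II"
    unfolding image_Un[symmetric] M[symmetric] by blast
  moreover have "M ` ?I \<inter> M ` ?II = {}"
  proof (rule ccontr)
    assume "M ` ?I \<inter> M ` ?II \<noteq> {}"
    then obtain a b where ab: "orb2 a = orb2 (f a)" "orb2 b \<noteq> orb2 (f b)" "M (orb2 a) = M (orb2 b)"
      by blast
    then have "orb2 b = orb2 a"
      using M_eq by metis
    then show False
      using ab image by metis
  qed
  moreover have "card (M ` ?I) = card ?I"
    using M_I by (intro card_image) (metis (no_types, lifting) inj_onI)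
  moreover have "card ?II = 2 * card (M ` ?II)"
  proof -
    \<comment> \<open>The fibres of \<open>M\<close> on \<open>?II\<close> are the pairs
      \<open>orb2 a\<close>, \<open>orb2 (f a)\<close>, whose members are distinct by the definition
      of \<open>?II\<close>.\<close>
    have "card {S. S \<in> ?II \<and> M S = X} = 2" if X: "X \<in> M ` ?II" for X
    proof -
      obtain a where a: "orb2 a \<noteq> orb2 (f a)" "X = M (orb2 a)"
        using X by blast
      have "M (orb2 (f a)) = X"
        by (auto simp: M_def image ff a(2))
      moreover have "orb2 (f a) \<in> ?II" "orb2 a \<in> ?II"
        using a(1) ff by auto
      moreover have "S \<in> {orb2 a, orb2 (f a)}" if S: "S \<in> ?II" "M S = X" for S
      proof -
        obtain b where "S = orb2 b"
          using S(1) by blast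
        then show ?thesis
          using M_eq[of a b] S(2) a(2) by auto
      qed
      ultimately have "{S. S \<in> ?II \<and> M S = X} = {orb2 a, orb2 (f a)}"
        using a(2) by blast
      then show ?thesis
        using a(1) by simp
    qed
    then have "(\<Sum>X\<in>M ` ?II. card {S. S \<in> ?II \<and> M S = X}) = 2 * card (M ` ?II)"
      by simp
    then show ?thesis
      using sum.image_gen[of ?II "\<lambda>_. 1 :: nat" M] by simp
  qed
  ultimately show ?thesis
    by (simp add: card_Un_disjoint)
qed

text \<open>A choice that depends only on the unordered pair of \<open>x\<close> and
  \<open>n x\<close> selects exactly one point of each two-element pair; fixed points are left out
  of \<open>H\<close>.\<close>

lemma involution_transversal:
  assumes "\<And>x. x \<in> X \<Longrightarrow> n x \<in> X" "\<And>x. x \<in> X \<Longrightarrow> n (n x) = x"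
  obtains H where "H \<subseteq> X" "\<And>x. x \<in> H \<Longrightarrow> n x \<notin> H" "\<And>x. x \<in> X \<Longrightarrow> n x \<noteq> x \<Longrightarrow> x \<in> H \<or> n x \<in> H"
proof -
  define pick :: "'a set \<Rightarrow> 'a" where "pick S = (SOME y. y \<in> S)" for S
  define H where "H = {x \<in> X. n x \<noteq> x \<and> pick {x, n x} = x}"
  have pick: "pick {x, n x} \<in> {x, n x}" for x
    unfolding pick_def by (rule someI[of _ x]) simp
  show thesis
  proof
    fix x assume x: "x \<in> X" "n x \<noteq> x"
    have "{n x, n (n x)} = {x, n x}"
      using assms x by auto
    then show "x \<in> H \<or> n x \<in> H"
      using x assms pick[of x] by (auto simp: H_def)
  next
    fix x assume x: "x \<in> H"
    then have "{n x, n (n x)} = {x, n x}"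
      using assms by (auto simp: H_def)
    then show "n x \<notin> H"
      using x unfolding H_def by (metis (mono_tags, lifting) mem_Collect_eq)
  qed (auto simp: H_def)
qed

text \<open>At a fixed point of \<open>n\<close> the value must be fixed by \<open>\<phi>\<close>,
  giving \<open>q\<close> choices; on a pair of swapped points one value is free and determines the
  other, giving \<open>q * q\<close> choices. Either way each point of \<open>X\<close> contributes
  a factor \<open>q\<close>.\<close>

lemma card_involution_equivariant:
  fixes \<phi> :: "'c::finite \<Rightarrow> 'c"
  assumes fin: "finite X" and n: "\<And>x. x \<in> X \<Longrightarrow> n x \<in> X" "\<And>x. x \<in> X \<Longrightarrow> n (n x) = x"
    and \<phi>: "\<And>c. \<phi> (\<phi> c) = c" and card: "card {c. \<phi> c = c} = q" "CARD('c) = q * q"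
  shows "card {g \<in> X \<rightarrow>\<^sub>E UNIV. \<forall>x\<in>X. g (n x) = \<phi> (g x)} = q ^ card X"
proof -
  obtain H where H: "H \<subseteq> X" "\<And>x. x \<in> H \<Longrightarrow> n x \<notin> H" "\<And>x. x \<in> X \<Longrightarrow> n x \<noteq> x \<Longrightarrow> x \<in> H \<or> n x \<in> H"
    using involution_transversal[OF n] by blast
  let ?G = "{g \<in> X \<rightarrow>\<^sub>E UNIV. \<forall>x\<in>X. g (n x) = \<phi> (g x)}"
  define Y where "Y = {x \<in> X. n x = x}"
  define D where "D = Pi\<^sub>E (Y \<union> H) (\<lambda>x. if x \<in> Y then {c. \<phi> c = c} else UNIV)"
  have disj: "Y \<inter> H = {}" "(Y \<union> H) \<inter> n ` H = {}"
    using H(1,2) n(2) by (auto simp: Y_def) (metis n(2) subsetD)+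
  have X: "X = Y \<union> H \<union> n ` H"
  proof
    show "X \<subseteq> Y \<union> H \<union> n ` H"
      using H(3) n(2) by (force simp: Y_def)
  qed (use H(1) n(1) in \<open>auto simp: Y_def\<close>)
  have finYH: "finite Y" "finite H"
    using fin H(1) finite_subset by (auto simp: Y_def)
  have "inj_on n H"
    using H(1) n(2) by (metis inj_onI subsetD)
  then have "card X = card Y + 2 * card H"
    using disj finYH by (subst X) (simp add: card_Un_disjoint card_image)
  moreover have "card D = q ^ card Y * (q * q) ^ card H"
  proof -
    have "(\<Prod>x\<in>H. card (if x \<in> Y then {c. \<phi> c = c} else UNIV)) = (\<Prod>x\<in>H. q * q)"
      using disj(1) by (intro prod.cong) (auto simp: card)
    moreover have "(\<Prod>x\<in>Y. card (if x \<in> Y then {c. \<phi> c = c} else UNIV)) = (\<Prod>x\<in>Y. q)"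
      by (intro prod.cong) (auto simp: card)
    ultimately have "card D = (\<Prod>x\<in>Y. q) * (\<Prod>x\<in>H. q * q)"
      unfolding D_def using finYH disj(1) by (simp add: card_PiE prod.union_disjoint)
    then show ?thesis
      by simp
  qed
  \<comment> \<open>The inverse of restriction puts the forced value \<open>\<phi> (h (n x))\<close>
    at the remaining points.\<close>
  moreover have "bij_betw (\<lambda>g. restrict g (Y \<union> H)) ?G D"
  proof (rule bij_betw_byWitness[where
        f' = "\<lambda>h. restrict (\<lambda>x. if x \<in> Y \<union> H then h x else \<phi> (h (n x))) X"])
    let ?ext = "\<lambda>h. restrict (\<lambda>x. if x \<in> Y \<union> H then h x else \<phi> (h (n x))) X"
    show "\<forall>g\<in>?G. ?ext (restrict g (Y \<union> H)) = g"
    proof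
      fix g assume g: "g \<in> ?G"
      show "?ext (restrict g (Y \<union> H)) = g"
      proof
        fix x
        consider "x \<notin> X" | "x \<in> Y \<union> H" | "x \<in> X" "x \<notin> Y \<union> H" by blast
        then show "?ext (restrict g (Y \<union> H)) x = g x"
        proof cases
          case 1
          then show ?thesis
            using g PiE_arb by fastforce
        next
          case 2
          then show ?thesis
            using X by auto
        next
          case 3
          then have "n x \<in> H"
            using H(3) by (auto simp: Y_def)
          moreover have "\<phi> (g (n x)) = g x"
            using g 3 \<phi> by simp
          ultimately show ?thesis
            using 3 by auto
        qed
      qed
    qed
    show "\<forall>h\<in>D. restrict (?ext h) (Y \<union> H) = h"
    proof
      fix h assume "h \<in> D"
      then show "restrict (?ext h) (Y \<union> H) = h"
        unfolding D_def using X by (intro ext) (auto simp: restrict_def PiE_def extensional_def)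
    qed
    show "(\<lambda>g. restrict g (Y \<union> H)) ` ?G \<subseteq> D"
    proof safe
      fix g assume "\<forall>x\<in>X. g (n x) = \<phi> (g x)"
      then have "\<phi> (g x) = g x" if "x \<in> Y" for x
        using that by (auto simp: Y_def)
      then show "restrict g (Y \<union> H) \<in> D"
        by (auto simp: D_def)
    qed
    show "?ext ` D \<subseteq> ?G"
    proof safe
      fix h x assume h: "h \<in> D" and x: "x \<in> X"
      consider "x \<in> Y" | "x \<in> H" | "x \<in> n ` H" "x \<notin> Y \<union> H"
        using x X disj by blast
      then show "?ext h (n x) = \<phi> (?ext h x)"
      proof cases
        case 1
        then have "n x = x" "\<phi> (h x) = h x"
          using PiE_mem[OF h[unfolded D_def], of x] by (simp_all add: Y_def)
        then show ?thesis
          using 1 x by auto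
      next
        case 2
        then have "n x \<notin> Y \<union> H"
          using disj by auto
        then show ?thesis
          using 2 x n by auto
      next
        case 3
        then have "n x \<in> H"
          using H(1) n(2) by auto
        then show ?thesis
          using 3 x n \<phi> by auto
      qed
    qed auto
  qed
  ultimately show ?thesis
    by (simp add: bij_betw_same_card power_add power_mult power2_eq_square)
qed

text \<open>Functions that are invariant under \<open>f\<close> are functions on the set of \<open>f\<close>-orbits, on which
  \<open>n\<close> acts as an involution.\<close>

lemma card_equivariant:
  fixes f n :: "'a::finite \<Rightarrow> 'a" and \<phi> :: "'c::finite \<Rightarrow> 'c"
  assumes f: "inj f" and n: "\<And>x. n (n x) = x" "\<And>x. n (f x) = f (n x)"
    and \<phi>: "\<And>c. \<phi> (\<phi> c) = c" and card: "card {c. \<phi> c = c} = q" "CARD('c) = q * q"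
  shows "card {g. (\<forall>a. g (f a) = g a) \<and> (\<forall>a. g (n a) = \<phi> (g a))} = q ^ card (range (orb f))"
proof -
  let ?X = "range (orb f)"
  let ?G = "{g \<in> ?X \<rightarrow>\<^sub>E UNIV. \<forall>S\<in>?X. g (n ` S) = \<phi> (g S)}"
  let ?F = "{g. (\<forall>a. g (f a) = g a) \<and> (\<forall>a. g (n a) = \<phi> (g a))}"
  have image: "n ` orb f a = orb f (n a)" for a
    by (rule image_orb_commute) (rule n(2))
  have fa: "orb f (f a) = orb f a" for a
    using funpow_in_orb[of 1 f a] by (intro orb_eqI[OF f]) simp
  have bij: "bij_betw (\<lambda>g a. g (orb f a)) ?G ?F"
  proof (rule bij_betw_imageI)
    show "inj_on (\<lambda>g a. g (orb f a)) ?G"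
    proof
      fix g h assume *: "g \<in> ?G" "h \<in> ?G" "(\<lambda>a. g (orb f a)) = (\<lambda>a. h (orb f a))"
      show "g = h"
        by (rule PiE_ext[of _ ?X "\<lambda>_. UNIV"]) (use * fun_cong[OF *(3)] in auto)
    qed
    show "(\<lambda>g a. g (orb f a)) ` ?G = ?F"
    proof (intro subset_antisym subsetI)
      fix g assume g: "g \<in> ?F"
      \<comment> \<open>The value on an orbit is read off at an arbitrary representative; invariance
        under \<open>f\<close> makes the choice immaterial.\<close>
      define h where "h = restrict (\<lambda>S. g (SOME x. x \<in> S)) ?X"
      have h: "h (orb f a) = g a" for a
      proof -
        have "(SOME x. x \<in> orb f a) \<in> orb f a"
          by (rule someI[of _ a]) (rule self_in_orb)
        then obtain i where i: "(SOME x. x \<in> orb f a) = (f ^^ i) a"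
          by (auto simp: orb_def)
        have "g ((f ^^ i) a) = g a"
          using g by (induction i) auto
        then show ?thesis
          by (simp add: h_def i)
      qed
      have "h \<in> ?G"
        using g by (auto simp: h image) (auto simp: h_def)
      moreover have "g = (\<lambda>a. h (orb f a))"
        by (simp add: h)
      ultimately show "g \<in> (\<lambda>g a. g (orb f a)) ` ?G"
        by blast
    qed (auto simp: fa simp flip: image)
  qed
  moreover have "card ?G = q ^ card ?X"
  proof (rule card_involution_equivariant[OF _ _ _ \<phi> card])
    show "n ` n ` S = S" for S
      using n(1) by (simp add: image_image)
  qed (auto simp: image)
  ultimately show ?thesis
    by (simp only: bij_betw_same_card[OF bij, symmetric])
qed

section \<open>Finite fields\<close>

lemma CHAR_eq_prime:
  fixes p n :: nat
  assumes "prime p" "CARD('f::{field,finite}) = p ^ n"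
  shows "CHAR('f) = p"
proof -
  have "prime CHAR('f)"
    using finite_imp_CHAR_pos[where ?'a = 'f] by (intro prime_CHAR_semidom) auto
  moreover have "CHAR('f) dvd p ^ n"
    using CHAR_dvd_CARD[where ?'a = 'f] assms(2) by simp
  ultimately show ?thesis
    using assms(1) prime_dvd_power primes_dvd_imp_eq by blast
qed

text \<open>The library states this for the class \<open>finite_field\<close>, which is not entailed by the sort
  \<open>{field,finite}\<close>.\<close>

lemma power_CARD_eq_same:
  fixes x :: "'f::{field,finite}"
  shows "x ^ CARD('f) = x"
proof (cases "x = 0")
  case False
  have "(\<Prod>y\<in>UNIV - {0}. y) = (\<Prod>y\<in>UNIV - {0}. x * y)"
    by (rule prod.reindex_bij_witness[of _ "\<lambda>y. x * y" "\<lambda>y. y / x"]) (use False in auto)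
  also have "\<dots> = x ^ card (UNIV - {0 :: 'f}) * (\<Prod>y\<in>UNIV - {0}. y)"
    by (simp add: prod.distrib)
  finally have "x ^ card (UNIV - {0 :: 'f}) = 1"
    by simp
  then show ?thesis
    by (simp add: card_Diff_singleton power_eq_if)
qed (simp add: zero_power)

text \<open>The nonempty fibres of \<open>h\<close> are translates of the kernel. In
  \<open>card_subfield\<close> this turns a small image into a large kernel.\<close>

lemma card_le_range_mult_kernel:
  fixes h :: "'a::{ab_group_add,finite} \<Rightarrow> 'b::ab_group_add"
  assumes add: "\<And>x y. h (x + y) = h x + h y"
  shows "CARD('a) \<le> card (range h) * card {x. h x = 0}"
proof -
  have diff: "h (x - y) = h x - h y" for x y
    using add[of "x - y" y] by simp
  have "card {x. h x = z} \<le> card {x. h x = 0}" for z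
  proof (cases "\<exists>y. h y = z")
    case True
    then obtain y where "h y = z" by blast
    then have "(\<lambda>x. x - y) ` {x. h x = z} \<subseteq> {x. h x = 0}"
      by (auto simp: diff)
    moreover have "inj_on (\<lambda>x. x - y) {x. h x = z}"
      by (simp add: inj_on_def)
    ultimately show ?thesis
      by (metis card_inj_on_le finite_class.finite_UNIV finite_subset subset_UNIV)
  qed simp
  then have "(\<Sum>z\<in>range h. card {x. h x = z}) \<le> card (range h) * card {x. h x = 0}"
    using sum_bounded_above[of "range h" "\<lambda>z. card {x. h x = z}" "card {x. h x = 0}"] by simp
  moreover have "(\<Union>z\<in>range h. {x. h x = z}) = UNIV"
    by auto
  then have "CARD('a) \<le> (\<Sum>z\<in>range h. card {x. h x = z})"
    using card_UN_le[of "range h" "\<lambda>z. {x. h x = z}"] by simp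
  ultimately show ?thesis
    by linarith
qed

lemma card_roots_power_eq:
  fixes a :: "'f::field"
  assumes "n \<ge> 2"
  shows "card {x. x ^ n = a * x} \<le> n"
proof -
  let ?P = "monom 1 n - monom a 1 :: 'f poly"
  have "coeff ?P n = 1"
    using assms by simp
  then have "?P \<noteq> 0"
    by (metis coeff_0 zero_neq_one)
  moreover have "degree ?P \<le> n"
    using assms by (intro degree_diff_le) (auto intro: order_trans[OF degree_monom_le])
  moreover have "{x. x ^ n = a * x} = {x. poly ?P x = 0}"
    by (auto simp: poly_monom)
  ultimately show ?thesis
    using card_poly_roots_bound[of ?P] by simp
qed

text \<open>The upper bound counts roots. For the lower bound, the additive map \<open>h\<close> has
  this set as its kernel, and its image lies among the at most \<open>?Q\<close> solutions of
  \<open>y ^ ?Q = - y\<close>, in a field with \<open>?Q * ?Q\<close> elements.\<close>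

lemma card_subfield:
  fixes p \<nu> :: nat
  assumes "prime p" "\<nu> > 0" and card: "CARD('f::{field,finite}) = p ^ (2 * \<nu>)"
  shows "card {x::'f. x ^ (p ^ \<nu>) = x} = p ^ \<nu>"
proof (rule antisym)
  let ?Q = "p ^ \<nu>"
  have Q2: "?Q \<ge> 2"
    using assms(1,2) by (metis Suc_leI order_trans power_increasing power_one_right prime_ge_1_nat prime_ge_2_nat One_nat_def)
  show "card {x::'f. x ^ ?Q = x} \<le> ?Q"
    using card_roots_power_eq[OF Q2, of "1 :: 'f"] by simp
  have char: "prime CHAR('f)" "CHAR('f) = p"
    using CHAR_eq_prime[OF assms(1) card] assms(1) by auto
  define h :: "'f \<Rightarrow> 'f" where "h x = x ^ ?Q - x" for x
  have minus: "(- x) ^ ?Q = - (x ^ ?Q)" for x :: 'f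
    using freshmans_dream'[of ?Q \<nu> x "- x"] char Q2 by (simp add: power_0_left eq_neg_iff_add_eq_0 add.commute)
  have QQ: "(x ^ ?Q) ^ ?Q = x" for x :: 'f
    using power_CARD_eq_same[of x] card by (simp add: mult_2 power_add flip: power_mult)
  have hadd: "h (x + y) = h x + h y" for x y
    unfolding h_def by (subst freshmans_dream'[of _ \<nu>]) (use char in auto)
  have "range h \<subseteq> {y. y ^ ?Q = (-1) * y}"
  proof safe
    fix x :: 'f
    have "(x ^ ?Q + (- x)) ^ ?Q = (x ^ ?Q) ^ ?Q + (- x) ^ ?Q"
      by (rule freshmans_dream'[of _ \<nu>]) (use char in auto)
    then show "h x ^ ?Q = - 1 * h x"
      by (simp add: h_def QQ minus)
  qed
  then have "card (range h) \<le> ?Q"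
    using card_roots_power_eq[OF Q2, of "-1 :: 'f"] by (meson card_mono finite le_trans)
  then have "?Q * ?Q \<le> ?Q * card {x. h x = 0}"
    using card_le_range_mult_kernel[of h, OF hadd] card by (metis le_trans mult_2 mult_le_mono1 power_add)
  then show "?Q \<le> card {x::'f. x ^ ?Q = x}"
    using prime_gt_0_nat[OF assms(1)] by (auto simp: h_def)
qed

text \<open>Both sides are monic of degree \<open>n\<close> and vanish on \<open>K\<close>, so a
  nonzero difference would have degree below \<open>n\<close> and at least \<open>n\<close>
  roots.\<close>

lemma prod_linear_factors_eq:
  fixes K :: "'f::field set"
  assumes K: "K = {x. x ^ n = x}" "finite K" "card K = n" and n: "n \<ge> 2"
  shows "(\<Prod>c\<in>K. [:- c, 1:]) = monom 1 n - monom 1 1"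
proof (rule ccontr)
  let ?P = "\<Prod>c\<in>K. [:- c, 1:]" and ?M = "monom 1 n - monom 1 1 :: 'f poly"
  assume "?P \<noteq> ?M"
  have deg: "degree ?P = n" "lead_coeff ?P = 1"
    using K(3) by (subst degree_prod_eq_sum_degree) (auto simp: lead_coeff_prod)
  have "degree ?M \<le> n"
    using n by (intro degree_diff_le) (auto intro: order_trans[OF degree_monom_le])
  then have "degree (?P - ?M) \<le> n"
    by (rule degree_diff_le[OF eq_refl[OF deg(1)]])
  moreover have "coeff (?P - ?M) n = 0"
    using deg n by simp
  ultimately have "degree (?P - ?M) < n"
    using \<open>?P \<noteq> ?M\<close> by (metis eq_iff_diff_eq_0 le_neq_implies_less leading_coeff_0_iff)
  moreover have "poly (?P - ?M) x = 0" if "x \<in> K" for x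
    using that K by (auto simp: poly_prod poly_monom)
  then have "card K \<le> card {x. poly (?P - ?M) x = 0}"
    using \<open>?P \<noteq> ?M\<close> by (intro card_mono poly_roots_finite) auto
  moreover have "card {x. poly (?P - ?M) x = 0} \<le> degree (?P - ?M)"
    using \<open>?P \<noteq> ?M\<close> by (intro card_poly_roots_bound) auto
  ultimately show False
    using K by linarith
qed

text \<open>This carries a factorization over the field to a ring that may have zero divisors, where
  the degree does not bound the number of roots. The induction splits off one linear factor and
  compares coefficients.\<close>

lemma prod_linear_factors_hom:
  fixes h :: "'a::comm_ring_1 \<Rightarrow> 'b::comm_ring_1"
  assumes h: "h 0 = 0" "h 1 = 1" "\<And>x y. h (x + y) = h x + h y" "\<And>x y. h (x * y) = h x * h y"
  shows "poly (map_poly h (\<Prod>c\<in>K. [:- c, 1:])) u = (\<Prod>c\<in>K. u - h c)"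
proof (induction K rule: infinite_finite_induct)
  case (insert c K)
  let ?P = "\<Prod>c\<in>K. [:- c, 1:]"
  have minus: "h (- x) = - h x" for x
    using h(3)[of x "- x"] h(1) by (simp add: eq_neg_iff_add_eq_0 add.commute)
  have diff: "h (x - y) = h x - h y" for x y
    using h(3)[of x "- y"] by (simp add: minus)
  have "map_poly h (\<Prod>c\<in>insert c K. [:- c, 1:]) = map_poly h (smult (- c) ?P + pCons 0 ?P)"
    using insert.hyps by (simp add: mult_pCons_left)
  also have "\<dots> = smult (- h c) (map_poly h ?P) + pCons 0 (map_poly h ?P)"
    by (intro poly_eqI) (auto simp: coeff_map_poly h minus diff coeff_pCons split: nat.splits)
  finally have "poly (map_poly h (\<Prod>c\<in>insert c K. [:- c, 1:])) u = (u - h c) * poly (map_poly h ?P) u"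
    by (simp add: left_diff_distrib)
  then show ?case
    using insert by simp
qed (use h in auto)

text \<open>For the embedding of the scalars into the group algebra this provides the hypothesis
  \<open>roots\<close> of \<open>card_idempotents\<close>.\<close>

lemma prod_minus_subfield:
  fixes h :: "'f::field \<Rightarrow> 'b::comm_ring_1"
  assumes h: "h 0 = 0" "h 1 = 1" "\<And>x y. h (x + y) = h x + h y" "\<And>x y. h (x * y) = h x * h y"
    and K: "K = {x. x ^ n = x}" "finite K" "card K = n" and n: "n \<ge> 2"
  shows "(\<Prod>c\<in>K. u - h c) = u ^ n - u"
proof -
  have minus: "h (- 1) = - 1"
    using h(3)[of 1 "- 1"] h(1,2) by (simp add: eq_neg_iff_add_eq_0 add.commute)
  have "(\<Prod>c\<in>K. u - h c) = poly (map_poly h (monom 1 n - monom 1 1)) u"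
    by (simp only: prod_linear_factors_eq[OF K n] flip: prod_linear_factors_hom[OF h])
  also have "map_poly h (monom 1 n - monom 1 1) = monom 1 n - monom 1 1"
    using n by (intro poly_eqI) (auto simp: coeff_map_poly h minus coeff_monom)
  finally show ?thesis
    by (simp add: poly_monom)
qed

section \<open>The group algebra\<close>

lemma finite_poly_mapping: "finite (UNIV :: ('g::finite \<Rightarrow>\<^sub>0 'f::{zero,finite}) set)"
proof -
  have "inj (Poly_Mapping.lookup :: ('g \<Rightarrow>\<^sub>0 'f) \<Rightarrow> _)"
    by (simp add: inj_def poly_mapping_eqI)
  then show ?thesis
    using finite_imageD[of "Poly_Mapping.lookup :: ('g \<Rightarrow>\<^sub>0 'f) \<Rightarrow> _" UNIV] finite_subset[OF subset_UNIV] by auto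
qed

lemma lookup_mult_finite:
  fixes u v :: "'g::{ab_group_add,finite} \<Rightarrow>\<^sub>0 'f::comm_ring_1"
  shows "Poly_Mapping.lookup (u * v) k = (\<Sum>g\<in>UNIV. Poly_Mapping.lookup u g * Poly_Mapping.lookup v (k - g))"
proof -
  have "(\<Sum>h. Poly_Mapping.lookup v h when k = g + h) = Poly_Mapping.lookup v (k - g)" for g
  proof -
    have "(\<lambda>h. Poly_Mapping.lookup v h when k = g + h) = (\<lambda>h. Poly_Mapping.lookup v h when h = k - g)"
      by (auto simp: fun_eq_iff when_def algebra_simps)
    then show ?thesis
      by (simp only: Sum_any_when_equal)
  qed
  then show ?thesis
    by (simp add: lookup_mult Sum_any.expand_superset[of UNIV])
qed

text \<open>For \<open>Q = p ^ \<nu>\<close> this is the conjugation for which the Hermitian inner product of \<open>u\<close> and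
  \<open>v\<close> is the constant coefficient of \<open>u\<close> times the conjugate of \<open>v\<close>.\<close>

definition star :: "nat \<Rightarrow> ('g::{ab_group_add,finite} \<Rightarrow>\<^sub>0 'f::field) \<Rightarrow> ('g \<Rightarrow>\<^sub>0 'f)" where
  "star Q u = Abs_poly_mapping (\<lambda>g. Poly_Mapping.lookup u (- g) ^ Q)"

lemma lookup_star [simp]: "Poly_Mapping.lookup (star Q u) g = Poly_Mapping.lookup u (- g) ^ Q"
  unfolding star_def by (subst lookup_Abs_poly_mapping) (auto intro: finite_subset[OF subset_UNIV])

lemma hermitian_inner_eq_lookup:
  fixes u v :: "'g::{ab_group_add,finite} \<Rightarrow>\<^sub>0 'f::field"
  shows "hermitian_inner p \<nu> u v = Poly_Mapping.lookup (u * star (p ^ \<nu>) v) 0"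
  by (simp add: hermitian_inner_def lookup_mult_finite)

text \<open>The coefficient of a product at \<open>g\<close> is the constant coefficient after
  multiplication by the monomial at \<open>- g\<close>, and an ideal is closed under that
  multiplication. So vanishing constant coefficients force the whole products to vanish.\<close>

lemma hermitian_dual_ideal:
  fixes C :: "('g::{ab_group_add,finite} \<Rightarrow>\<^sub>0 'f::field) set"
  assumes "abelian_code C"
  shows "hermitian_dual p \<nu> C = {v. \<forall>c\<in>C. c * star (p ^ \<nu>) v = 0}"
proof (intro Set.set_eqI iffI)
  fix v assume v: "v \<in> hermitian_dual p \<nu> C"
  have "c * star (p ^ \<nu>) v = 0" if "c \<in> C" for c
  proof (rule poly_mapping_eqI)
    fix g :: 'g
    let ?s = "Poly_Mapping.single (- g) (1 :: 'f)"
    have "?s * c \<in> C"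
      using assms that by (simp add: abelian_code_iff)
    then have "Poly_Mapping.lookup (?s * c * star (p ^ \<nu>) v) 0 = 0"
      using v by (simp add: hermitian_dual_def hermitian_inner_eq_lookup)
    then have "Poly_Mapping.lookup (?s * (c * star (p ^ \<nu>) v)) 0 = 0"
      by (simp only: mult.assoc)
    also have "Poly_Mapping.lookup (?s * (c * star (p ^ \<nu>) v)) 0 =
        (\<Sum>h\<in>UNIV. if h = - g then Poly_Mapping.lookup (c * star (p ^ \<nu>) v) (- h) else 0)"
      unfolding lookup_mult_finite[of ?s]
      by (intro sum.cong) (auto simp: lookup_single when_def)
    finally show "Poly_Mapping.lookup (c * star (p ^ \<nu>) v) g = Poly_Mapping.lookup 0 g"
      by simp
  qed
  then show "v \<in> {v. \<forall>c\<in>C. c * star (p ^ \<nu>) v = 0}"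
    by blast
qed (auto simp: hermitian_dual_def hermitian_inner_eq_lookup)

section \<open>Conjugation and projections for the Hermitian form\<close>

locale hermitian_field =
  fixes p \<nu> Q :: nat and tf :: "'f::{field,finite} itself"
  assumes prime: "prime p" and \<nu>: "\<nu> > 0" and card_f: "CARD('f) = p ^ (2 * \<nu>)" and Q: "Q = p ^ \<nu>"
begin

lemma Q_ge_2: "Q \<ge> 2"
  unfolding Q using prime \<nu>
  by (metis Suc_leI One_nat_def order_trans power_increasing power_one_right prime_ge_1_nat prime_ge_2_nat)

lemma power_Q_add: "(x + y :: 'f) ^ Q = x ^ Q + y ^ Q"
  by (rule freshmans_dream'[of _ \<nu>]) (use CHAR_eq_prime[OF prime card_f] prime Q in auto)

lemma power_Q_sum: "(sum f A :: 'f) ^ Q = (\<Sum>x\<in>A. f x ^ Q)"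
  by (rule freshmans_dream_sum'[of _ \<nu>]) (use CHAR_eq_prime[OF prime card_f] prime Q in auto)

lemma power_Q_Q: "((x :: 'f) ^ Q) ^ Q = x"
  using power_CARD_eq_same[of x] card_f Q by (simp add: mult_2 power_add flip: power_mult)

lemma star_add: "star Q (u + v :: 'g::{ab_group_add,finite} \<Rightarrow>\<^sub>0 'f) = star Q u + star Q v"
  by (rule poly_mapping_eqI) (simp add: lookup_add power_Q_add)

lemma star_diff: "star Q (u - v :: 'g::{ab_group_add,finite} \<Rightarrow>\<^sub>0 'f) = star Q u - star Q v"
  using star_add[of "u - v" v] by (simp add: algebra_simps)

lemma star_0: "star Q (0 :: 'g::{ab_group_add,finite} \<Rightarrow>\<^sub>0 'f) = 0"
  using star_add[of 0 0] by simp

lemma star_1: "star Q (1 :: 'g::{ab_group_add,finite} \<Rightarrow>\<^sub>0 'f) = 1"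
  using Q_ge_2 by (intro poly_mapping_eqI) (simp add: lookup_one when_def power_0_left)

lemma star_mult: "star Q (u * v :: 'g::{ab_group_add,finite} \<Rightarrow>\<^sub>0 'f) = star Q u * star Q v"
proof (rule poly_mapping_eqI)
  fix k
  have "Poly_Mapping.lookup (star Q (u * v)) k =
      (\<Sum>g\<in>UNIV. Poly_Mapping.lookup u g ^ Q * Poly_Mapping.lookup v (- k - g) ^ Q)"
    by (simp add: lookup_mult_finite power_Q_sum power_mult_distrib)
  also have "\<dots> = (\<Sum>g\<in>UNIV. Poly_Mapping.lookup u (- g) ^ Q * Poly_Mapping.lookup v (- (k - g)) ^ Q)"
    by (rule sum.reindex_bij_witness[of _ uminus uminus]) auto
  finally show "Poly_Mapping.lookup (star Q (u * v)) k = Poly_Mapping.lookup (star Q u * star Q v) k"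
    by (simp add: lookup_mult_finite)
qed

lemma star_star: "star Q (star Q u) = (u :: 'g::{ab_group_add,finite} \<Rightarrow>\<^sub>0 'f)"
  by (rule poly_mapping_eqI) (simp add: power_Q_Q)

text \<open>Let \<open>\<Phi>\<close> record the inner products with a basis \<open>B\<close> of
  \<open>C\<close>. It is injective on \<open>C\<close> because \<open>C\<close> meets its dual
  trivially, and a count makes it surjective, so some \<open>c\<close> in \<open>C\<close> has the
  same inner products as \<open>v\<close>. The count copes with \<open>\<Phi>\<close> being only
  semilinear.\<close>

lemma hermitian_projection:
  fixes C :: "('g::{ab_group_add,finite} \<Rightarrow>\<^sub>0 'f) set"
  assumes C: "abelian_code C" and hcd: "hermitian_complementary_dual p \<nu> C"
  obtains c where "c \<in> C" "v - c \<in> hermitian_dual p \<nu> C"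
proof -
  let ?scale = "\<lambda>k (u :: 'g \<Rightarrow>\<^sub>0 'f). Poly_Mapping.single 0 k * u"
  let ?ip = "hermitian_inner p \<nu>"
  interpret vector_space ?scale
    by unfold_locales (simp_all add: algebra_simps single_add mult_single)
  have diff: "?ip u (v - w) = ?ip u v - ?ip u w" for u v w :: "'g \<Rightarrow>\<^sub>0 'f"
    by (simp add: hermitian_inner_eq_lookup star_diff lookup_minus right_diff_distrib flip: Q)
  have ip_scale: "?ip (?scale k u) v = k * ?ip u v" for k and u v :: "'g \<Rightarrow>\<^sub>0 'f"
    by (simp add: hermitian_inner_def sum_distrib_left mult.assoc flip: mult_map_scale_conv_mult)
       (auto simp: Poly_Mapping.map.rep_eq when_def mult.assoc intro: sum.cong)
  have sub: "subspace {u. ?ip u w = 0}" for w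
    unfolding subspace_def
    by (auto simp: ip_scale) (simp_all add: hermitian_inner_def lookup_add distrib_right sum.distrib)
  obtain B where B: "B \<subseteq> C" "independent B" "C \<subseteq> span B"
    using maximal_independent_subset[of C] by blast
  have finR: "finite (X :: ('g \<Rightarrow>\<^sub>0 'f) set)" for X
    by (rule finite_subset[OF subset_UNIV finite_poly_mapping])
  \<comment> \<open>The form is linear in its first argument, so orthogonality needs testing on the
    basis only.\<close>
  have in_dual: "w \<in> hermitian_dual p \<nu> C" if "\<And>b. b \<in> B \<Longrightarrow> ?ip b w = 0" for w
    using that B(3) span_minimal[OF _ sub, of B w] by (auto simp: hermitian_dual_def)
  define L where "L = (\<lambda>f :: ('g \<Rightarrow>\<^sub>0 'f) \<Rightarrow> 'f. \<Sum>b\<in>B. ?scale (f b) b)"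
  define \<Phi> where "\<Phi> = (\<lambda>c. restrict (\<lambda>b. ?ip b c) B)"
  \<comment> \<open>Linear independence gives \<open>C\<close> at least as many elements as the
    codomain of \<open>\<Phi>\<close>.\<close>
  have "inj_on L (B \<rightarrow>\<^sub>E UNIV)"
  proof
    fix f g assume fg: "f \<in> B \<rightarrow>\<^sub>E UNIV" "g \<in> B \<rightarrow>\<^sub>E UNIV" "L f = L g"
    have "(\<Sum>b\<in>B. ?scale (f b - g b) b) = 0"
      using fg(3) by (simp add: L_def scale_left_diff_distrib sum_subtractf)
    then have "f b - g b = 0" if "b \<in> B" for b
      by (rule independent_explicit_finite_subsets[THEN iffD1, OF B(2), rule_format, OF order.refl finR])
        (use that in auto)
    then show "f = g"
      using fg by (intro PiE_ext) auto
  qed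
  moreover have "L f \<in> C" for f
  proof -
    have "subspace C"
      using C by (simp add: subspace_def abelian_code_iff)
    then show ?thesis
      using B(1) unfolding L_def by (intro subspace_sum subspace_scale) auto
  qed
  ultimately have "card (B \<rightarrow>\<^sub>E (UNIV :: 'f set)) \<le> card C"
    using finR by (intro card_inj_on_le[of L]) auto
  moreover have inj: "inj_on \<Phi> C"
  proof
    fix c d assume cd: "c \<in> C" "d \<in> C" "\<Phi> c = \<Phi> d"
    have "?ip b c = ?ip b d" if "b \<in> B" for b
      using fun_cong[OF cd(3), of b] that by (simp add: \<Phi>_def)
    then have "c - d \<in> hermitian_dual p \<nu> C"
      by (intro in_dual) (simp add: diff)
    moreover have "c - d \<in> C"
      using C cd(1,2) unfolding abelian_code_iff
      by (metis diff_conv_add_uminus mult_minus1)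
    ultimately have "c - d \<in> {0}"
      using hcd unfolding hermitian_complementary_dual_def by blast
    then show "c = d"
      by simp
  qed
  ultimately have "card (B \<rightarrow>\<^sub>E (UNIV :: 'f set)) \<le> card (\<Phi> ` C)"
    by (simp add: card_image)
  moreover have "\<Phi> ` C \<subseteq> B \<rightarrow>\<^sub>E UNIV"
    by (auto simp: \<Phi>_def)
  ultimately have surj: "\<Phi> ` C = B \<rightarrow>\<^sub>E UNIV"
    using finR[of B] by (intro card_seteq) (auto intro!: finite_PiE)
  have "\<Phi> v \<in> B \<rightarrow>\<^sub>E UNIV"
    by (auto simp: \<Phi>_def)
  then obtain c where c: "c \<in> C" "\<Phi> c = \<Phi> v"
    using surj by (metis imageE)
  have "?ip b c = ?ip b v" if "b \<in> B" for b
    using fun_cong[OF c(2), of b] that by (simp add: \<Phi>_def)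
  then have "v - c \<in> hermitian_dual p \<nu> C"
    by (intro in_dual) (simp add: diff)
  with c show thesis
    using that by blast
qed

text \<open>Projecting 1 to \<open>e\<close> yields \<open>c * star Q e = c\<close> on
  \<open>C\<close>; for \<open>c = e\<close> this makes \<open>e\<close> self-conjugate and then
  idempotent. Conversely, if \<open>x\<close> lies in both the ideal of \<open>e\<close> and its
  dual, then \<open>star Q x\<close> is a multiple of \<open>e\<close> that \<open>e\<close>
  annihilates, hence 0.\<close>

lemma hermitian_complementary_dual_iff:
  fixes C :: "('g::{ab_group_add,finite} \<Rightarrow>\<^sub>0 'f) set"
  shows "abelian_code C \<and> hermitian_complementary_dual p \<nu> C \<longleftrightarrow>
    (\<exists>e. e * e = e \<and> star Q e = e \<and> C = range ((*) e))"
proof safe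
  assume C: "abelian_code C" and hcd: "hermitian_complementary_dual p \<nu> C"
  obtain e where e: "e \<in> C" "1 - e \<in> hermitian_dual p \<nu> C"
    using hermitian_projection[OF C hcd] .
  then have unit: "c * star Q e = c" if "c \<in> C" for c
    using that by (simp add: hermitian_dual_ideal[OF C] star_diff star_1 right_diff_distrib flip: Q)
  have "star Q e = star Q (e * star Q e)"
    using unit[OF e(1)] by simp
  also have "\<dots> = e * star Q e"
    by (simp add: star_mult star_star mult.commute)
  finally have star: "star Q e = e"
    using unit[OF e(1)] by simp
  moreover have "C = range ((*) e)"
  proof
    show "C \<subseteq> range ((*) e)"
      using unit by (metis star mult.commute rangeI subsetI)
    show "range ((*) e) \<subseteq> C"
      using C e(1) by (auto simp: abelian_code_iff mult.commute[of e])
  qed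
  ultimately show "\<exists>e. e * e = e \<and> star Q e = e \<and> C = range ((*) e)"
    using unit[OF e(1)] by auto
next
  fix e :: "'g \<Rightarrow>\<^sub>0 'f"
  assume e: "e * e = e" "star Q e = e"
  show C: "abelian_code (range ((*) e))"
    unfolding abelian_code_iff
  proof (intro conjI ballI allI)
    show "0 \<in> range ((*) e)"
      by (auto simp: image_iff intro: exI[of _ 0])
  next
    fix x y assume "x \<in> range ((*) e)" "y \<in> range ((*) e)"
    then show "x + y \<in> range ((*) e)"
      by (auto simp flip: distrib_left)
  next
    fix r x assume "x \<in> range ((*) e)"
    then show "r * x \<in> range ((*) e)"
      by (auto simp: mult.left_commute[of r e])
  qed
  have "x = 0" if x: "x \<in> range ((*) e)" "x \<in> hermitian_dual p \<nu> (range ((*) e))" for x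
  proof -
    obtain r where r: "x = e * r"
      using x(1) by blast
    have "e * star Q x = 0"
      using x(2) unfolding hermitian_dual_ideal[OF C] Q[symmetric]
      by (metis (mono_tags, lifting) mem_Collect_eq mult.right_neutral rangeI)
    moreover have "star Q x = e * star Q r"
      by (simp add: r star_mult e)
    ultimately have "star Q x = 0"
      by (metis e(1) mult.assoc)
    then show ?thesis
      by (metis star_star star_0)
  qed
  moreover have "0 \<in> range ((*) e)"
    by (auto simp: image_iff intro: exI[of _ 0])
  moreover have "0 \<in> hermitian_dual p \<nu> (range ((*) e))"
    by (simp add: hermitian_dual_ideal[OF C] star_0 flip: Q)
  ultimately show "hermitian_complementary_dual p \<nu> (range ((*) e))"
    unfolding hermitian_complementary_dual_def by blast
qed

text \<open>Idempotents generating the same ideal act as identity on each other, so they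
  coincide.\<close>

lemma card_hermitian_complementary_dual:
  "card {C :: ('g::{ab_group_add,finite} \<Rightarrow>\<^sub>0 'f) set. abelian_code C \<and> hermitian_complementary_dual p \<nu> C} =
   card {e :: 'g \<Rightarrow>\<^sub>0 'f. e * e = e \<and> star Q e = e}"
proof -
  let ?I = "{e :: 'g \<Rightarrow>\<^sub>0 'f. e * e = e \<and> star Q e = e}"
  have "inj_on (\<lambda>e. range ((*) e)) ?I"
  proof
    fix e f assume *: "e \<in> ?I" "f \<in> ?I" "range ((*) e) = range ((*) f)"
    have "e \<in> range ((*) f)" "f \<in> range ((*) e)"
      using *(3) by (metis mult.right_neutral rangeI)+
    then obtain r s where rs: "e = f * r" "f = e * s"
      by blast
    have "f * e = e" "e * f = f"
      using * rs by (metis (mono_tags, lifting) mem_Collect_eq mult.assoc)+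
    then show "e = f"
      by (simp add: mult.commute)
  qed
  moreover have "{C :: ('g \<Rightarrow>\<^sub>0 'f) set. abelian_code C \<and> hermitian_complementary_dual p \<nu> C} =
      (\<lambda>e. range ((*) e)) ` ?I"
    unfolding hermitian_complementary_dual_iff by auto
  ultimately show ?thesis
    by (simp add: card_image)
qed

end

section \<open>Counting self-conjugate idempotents\<close>

lemma nat_multiple_0 [simp]: "nat_multiple 0 a = 0"
  by (simp add: nat_multiple_def)

lemma nat_multiple_Suc [simp]: "nat_multiple (Suc n) a = a + nat_multiple n a"
  by (simp add: nat_multiple_def)

lemma nat_multiple_zero [simp]: "nat_multiple n 0 = 0"
  by (induction n) auto

lemma nat_multiple_add: "nat_multiple (m + n) a = nat_multiple m a + nat_multiple n a"
  by (induction m) (auto simp: add.assoc)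

lemma nat_multiple_mult: "nat_multiple (m * n) a = nat_multiple m (nat_multiple n a)"
  by (induction m) (auto simp: nat_multiple_add)

lemma nat_multiple_uminus: "nat_multiple n (- a) = - nat_multiple n a"
  by (induction n) auto

lemma nat_multiple_distrib: "nat_multiple n (a + b) = nat_multiple n a + nat_multiple n b"
  by (induction n) (auto simp: algebra_simps)

lemma nat_multiple_Pair: "nat_multiple n (a, b) = (nat_multiple n a, nat_multiple n b)"
  by (induction n) (auto simp: zero_prod_def)

text \<open>Translation by \<open>a\<close> permutes the group, so the sum of all elements is
  unchanged when \<open>a\<close> is added once for each of them.\<close>

lemma nat_multiple_CARD: "nat_multiple CARD('g) (a :: 'g::{ab_group_add,finite}) = 0"
proof -
  have const: "(\<Sum>x\<in>S. a) = nat_multiple (card S) a" if "finite S" for S :: "'g set"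
    using that by (induction S) auto
  have "(\<Sum>x\<in>UNIV. x) = (\<Sum>x\<in>UNIV. a + x)"
    by (rule sum.reindex_bij_witness[of _ "\<lambda>x. a + x" "\<lambda>x. x - a"]) auto
  then show ?thesis
    by (simp add: sum.distrib const)
qed

text \<open>A Bezout coefficient \<open>x\<close> of \<open>n\<close> modulo the group order inverts
  multiplication by \<open>n\<close>.\<close>

lemma inj_nat_multiple:
  assumes "coprime n CARD('g)" "n > 0"
  shows "inj (nat_multiple n :: 'g::{ab_group_add,finite} \<Rightarrow> 'g)"
proof
  fix a b :: 'g
  assume ab: "nat_multiple n a = nat_multiple n b"
  let ?c = "a - b"
  have "nat_multiple n ?c = 0"
    using ab nat_multiple_distrib[of n ?c b] by simp
  moreover obtain x y where "x * n = y * CARD('g) + 1"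
    using bezout_nat[of n "CARD('g)"] assms by (metis coprime_imp_gcd_eq_1 mult.commute neq0_conv)
  then have "nat_multiple x (nat_multiple n ?c) = nat_multiple y (nat_multiple CARD('g) ?c) + ?c"
    by (metis nat_multiple_0 nat_multiple_Suc One_nat_def add.right_neutral nat_multiple_add nat_multiple_mult)
  ultimately show "a = b"
    by (simp add: nat_multiple_CARD)
qed

lemma single_power:
  "Poly_Mapping.single g c ^ n = Poly_Mapping.single (nat_multiple n g) (c ^ n :: 'f::comm_ring_1)"
  by (induction n) (auto simp: mult_single)

lemma poly_mapping_sum_single:
  fixes u :: "'g::finite \<Rightarrow>\<^sub>0 'f::comm_monoid_add"
  shows "u = (\<Sum>g\<in>UNIV. Poly_Mapping.single g (Poly_Mapping.lookup u g))"
  by (rule poly_mapping_eqI) (simp add: lookup_sum lookup_single when_def)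

section \<open>Fixed points of the power map and of conjugation\<close>

context hermitian_field
begin

lemma CHAR_group_algebra: "CHAR('g::{ab_group_add,finite} \<Rightarrow>\<^sub>0 'f) = p"
proof -
  have "of_nat p = (0 :: 'f)"
    using CHAR_eq_prime[OF prime card_f] of_nat_CHAR[where ?'a = 'f] by simp
  then have "of_nat p = (0 :: 'g \<Rightarrow>\<^sub>0 'f)"
    by (metis single_of_nat single_zero)
  then have "CHAR('g \<Rightarrow>\<^sub>0 'f) dvd p"
    by (simp add: of_nat_eq_0_iff_char_dvd)
  then show ?thesis
    using prime CHAR_not_1[where ?'a = "'g \<Rightarrow>\<^sub>0 'f"] by (auto simp: prime_nat_iff)
qed

text \<open>In characteristic \<open>p\<close> the power of a sum of monomials is the sum of their
  powers, and the monomial at \<open>g\<close> moves to \<open>nat_multiple m g\<close>.\<close>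

lemma lookup_power_prime:
  fixes u :: "'g::{ab_group_add,finite} \<Rightarrow>\<^sub>0 'f"
  assumes "m = p ^ n"
  shows "Poly_Mapping.lookup (u ^ m) h = (\<Sum>g | nat_multiple m g = h. Poly_Mapping.lookup u g ^ m)"
proof -
  have "u ^ m = (\<Sum>g\<in>UNIV. Poly_Mapping.single g (Poly_Mapping.lookup u g)) ^ m"
    by (simp flip: poly_mapping_sum_single)
  also have "\<dots> = (\<Sum>g\<in>UNIV. Poly_Mapping.single (nat_multiple m g) (Poly_Mapping.lookup u g ^ m))"
    using prime assms
    by (subst freshmans_dream_sum'[of _ n]) (simp_all add: CHAR_group_algebra single_power)
  finally show ?thesis
    by (simp add: lookup_sum lookup_single when_def sum.If_cases)
qed

text \<open>The \<open>Q\<close>-th power map kills the \<open>p\<close>-part of the group after finitely many iterations, so its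
  fixed points live on the factor of order prime to \<open>p\<close>.\<close>

lemma power_Q_fixed_iff:
  fixes u :: "'a::{ab_group_add,finite} \<times> 'b::{ab_group_add,finite} \<Rightarrow>\<^sub>0 'f"
  assumes A: "\<not> p dvd CARD('a)" and P: "CARD('b) = p ^ k"
  shows "u ^ Q = u \<longleftrightarrow>
    (\<forall>a b. b \<noteq> 0 \<longrightarrow> Poly_Mapping.lookup u (a, b) = 0) \<and>
    (\<forall>a. Poly_Mapping.lookup u (nat_multiple Q a, 0) = Poly_Mapping.lookup u (a, 0) ^ Q)"
    (is "_ \<longleftrightarrow> ?supp \<and> ?frob")
proof -
  have "coprime Q CARD('a)"
    using A prime Q by (simp add: prime_imp_coprime)
  then have inj: "inj (nat_multiple Q :: 'a \<Rightarrow> 'a)"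
    using Q_ge_2 by (intro inj_nat_multiple) auto
  then have surj: "surj (nat_multiple Q :: 'a \<Rightarrow> 'a)"
    by (simp add: finite_UNIV_inj_surj)
  have Q_pos: "Q > 0"
    using Q_ge_2 by simp
  have supp: ?supp if fixed: "u ^ Q = u"
  proof safe
    fix a :: 'a and b :: 'b assume "b \<noteq> 0"
    have "nat_multiple (Q ^ k) c = 0" for c :: 'b
    proof -
      \<comment> \<open>As \<open>\<nu> > 0\<close>, the order of the \<open>p\<close>-group divides
        \<open>Q ^ k\<close>, so this multiple annihilates it, and \<open>u = u ^ (Q ^ k)\<close>
        has no term with a nonzero second component.\<close>
      have "Q ^ k = p ^ ((\<nu> - 1) * k) * CARD('b)"
        using \<nu> P by (simp add: Q diff_mult_distrib flip: power_mult power_add)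
      then show ?thesis
        by (simp add: nat_multiple_mult nat_multiple_CARD)
    qed
    then have empty: "{g. nat_multiple (Q ^ k) g = (a, b)} = {}"
      using \<open>b \<noteq> 0\<close> by (auto simp: nat_multiple_Pair)
    have Qk: "Q ^ k = p ^ (\<nu> * k)"
      by (simp add: Q power_mult)
    have "u ^ (Q ^ k) = u"
      by (induction k) (simp_all add: fixed power_mult)
    moreover have "Poly_Mapping.lookup (u ^ (Q ^ k)) (a, b) = 0"
      by (simp only: lookup_power_prime[OF Qk] empty sum.empty)
    ultimately show "Poly_Mapping.lookup u (a, b) = 0"
      by simp
  qed
  have frob: "Poly_Mapping.lookup (u ^ Q) (nat_multiple Q a, 0) = Poly_Mapping.lookup u (a, 0) ^ Q"
    if supp: ?supp for a
  proof -
    \<comment> \<open>By injectivity on the first factor, every other index has the form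
      \<open>(a, b)\<close> with \<open>b\<close> nonzero, where \<open>u\<close> vanishes.\<close>
    have "(\<Sum>g\<in>{g. nat_multiple Q g = (nat_multiple Q a, 0)}. Poly_Mapping.lookup u g ^ Q) =
        (\<Sum>g\<in>{(a, 0)}. Poly_Mapping.lookup u g ^ Q)"
    proof (rule sum.mono_neutral_right)
      show "\<forall>g\<in>{g. nat_multiple Q g = (nat_multiple Q a, 0)} - {(a, 0)}. Poly_Mapping.lookup u g ^ Q = 0"
        using supp injD[OF inj] Q_pos by (auto simp: nat_multiple_Pair)
    qed (auto simp: nat_multiple_Pair)
    then show ?thesis
      by (simp add: lookup_power_prime[OF Q])
  qed
  show ?thesis
  proof
    assume "u ^ Q = u"
    then show "?supp \<and> ?frob"
      using supp frob by metis
  next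
    assume *: "?supp \<and> ?frob"
    show "u ^ Q = u"
    proof (rule poly_mapping_eqI)
      fix g :: "'a \<times> 'b"
      obtain a b where g: "g = (a, b)" by fastforce
      show "Poly_Mapping.lookup (u ^ Q) g = Poly_Mapping.lookup u g"
      proof (cases "b = 0")
        case True
        obtain a' where "a = nat_multiple Q a'"
          using surj by (metis surjD)
        then show ?thesis
          using * frob True by (simp add: g)
      next
        case False
        have "Poly_Mapping.lookup u (x, y) ^ Q = 0" if "nat_multiple Q (x, y) = g" for x y
          using * False Q_pos that by (cases "y = 0") (auto simp: g nat_multiple_Pair)
        then have "(\<Sum>h | nat_multiple Q h = g. Poly_Mapping.lookup u h ^ Q) = 0"
          by (intro sum.neutral) auto
        then show ?thesis
          using * False by (simp add: lookup_power_prime[OF Q] g)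
      qed
    qed
  qed
qed

text \<open>For functions on the first factor the two conditions read
  \<open>f (nat_multiple Q a) = f a ^ Q\<close> and \<open>f (- a) = f a ^ Q\<close>. Given the
  second, the first amounts to invariance under \<open>- nat_multiple Q a\<close>, as the power map
  on the field is an involution. Then \<open>card_equivariant\<close> applies with negation as
  \<open>n\<close>.\<close>

lemma card_power_Q_star_fixed:
  assumes A: "\<not> p dvd CARD('a::{ab_group_add,finite})" and P: "CARD('b::{ab_group_add,finite}) = p ^ k"
  shows "card {u :: 'a \<times> 'b \<Rightarrow>\<^sub>0 'f. u ^ Q = u \<and> star Q u = u} =
    Q ^ card (range (orb (\<lambda>a::'a. - nat_multiple Q a)))"
proof -
  let ?T = "{u :: 'a \<times> 'b \<Rightarrow>\<^sub>0 'f. u ^ Q = u \<and> star Q u = u}"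
  let ?F = "{f :: 'a \<Rightarrow> 'f. (\<forall>a. f (- nat_multiple Q a) = f a) \<and> (\<forall>a. f (- a) = f a ^ Q)}"
  let ?ext = "\<lambda>f :: 'a \<Rightarrow> 'f. Abs_poly_mapping (\<lambda>(a, b :: 'b). if b = 0 then f a else 0)"
  have lookup_ext: "Poly_Mapping.lookup (?ext f) (a, b) = (if b = 0 then f a else 0)" for f a b
    by (subst lookup_Abs_poly_mapping) (auto intro: finite_subset[OF subset_UNIV])
  have star_iff: "star Q u = u \<longleftrightarrow> (\<forall>g. Poly_Mapping.lookup u (- g) = Poly_Mapping.lookup u g ^ Q)"
    for u :: "'a \<times> 'b \<Rightarrow>\<^sub>0 'f"
    unfolding poly_mapping_eq_iff fun_eq_iff lookup_star by (metis minus_minus)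
  have Q_pos: "Q > 0"
    using Q_ge_2 by simp
  have "bij_betw (\<lambda>u a. Poly_Mapping.lookup u (a, 0)) ?T ?F"
  proof (rule bij_betw_byWitness[where f' = ?ext])
    show "\<forall>u\<in>?T. ?ext (\<lambda>a. Poly_Mapping.lookup u (a, 0)) = u"
    proof
      fix u assume "u \<in> ?T"
      then have "Poly_Mapping.lookup u (a, b) = 0" if "b \<noteq> 0" for a b
        using that power_Q_fixed_iff[OF A P, of u] by blast
      then show "?ext (\<lambda>a. Poly_Mapping.lookup u (a, 0)) = u"
        unfolding poly_mapping_eq_iff fun_eq_iff by (simp add: lookup_ext)
    qed
    show "\<forall>f\<in>?F. (\<lambda>a. Poly_Mapping.lookup (?ext f) (a, 0)) = f"
      by (simp add: lookup_ext)
    show "(\<lambda>u a. Poly_Mapping.lookup u (a, 0)) ` ?T \<subseteq> ?F"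
    proof safe
      fix u :: "'a \<times> 'b \<Rightarrow>\<^sub>0 'f" and a :: 'a
      assume "u ^ Q = u" "star Q u = u"
      then have minus: "Poly_Mapping.lookup u (- x, 0) = Poly_Mapping.lookup u (x, 0) ^ Q"
        and frob: "Poly_Mapping.lookup u (nat_multiple Q x, 0) = Poly_Mapping.lookup u (x, 0) ^ Q" for x
        using star_iff[of u] power_Q_fixed_iff[OF A P, of u] by (metis minus_zero uminus_Pair, blast)
      show "Poly_Mapping.lookup u (- a, 0) = Poly_Mapping.lookup u (a, 0) ^ Q"
        by (rule minus)
      show "Poly_Mapping.lookup u (- nat_multiple Q a, 0) = Poly_Mapping.lookup u (a, 0)"
        by (simp add: minus frob power_Q_Q)
    qed
    show "?ext ` ?F \<subseteq> ?T"
    proof safe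
      fix f :: "'a \<Rightarrow> 'f" assume f: "\<forall>a. f (- nat_multiple Q a) = f a" "\<forall>a. f (- a) = f a ^ Q"
      have "f (nat_multiple Q a) = f a ^ Q" for a
        using f by (metis minus_minus)
      then show "?ext f ^ Q = ?ext f"
        unfolding power_Q_fixed_iff[OF A P] by (simp add: lookup_ext)
      show "star Q (?ext f) = ?ext f"
        unfolding star_iff using f Q_pos by (auto simp: lookup_ext)
    qed
  qed
  then have "card ?T = card ?F"
    by (rule bij_betw_same_card)
  also have "coprime Q CARD('a)"
    using A prime Q by (simp add: prime_imp_coprime)
  then have "inj (\<lambda>a::'a. - nat_multiple Q a)"
    using inj_nat_multiple[of Q] Q_ge_2 by (simp add: inj_def)
  then have "card ?F = Q ^ card (range (orb (\<lambda>a::'a. - nat_multiple Q a)))"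
    using card_subfield[OF prime \<nu> card_f] card_f
    by (intro card_equivariant) (simp_all add: nat_multiple_uminus power_Q_Q[unfolded Q] Q mult_2 power_add)
  finally show ?thesis .
qed

text \<open>This is \<open>card_idempotents\<close> for \<open>?T\<close>, with the subfield of
  \<open>Q\<close> elements, embedded as constants, in the role of \<open>K\<close>.\<close>

lemma card_star_idempotents:
  assumes A: "\<not> p dvd CARD('a::{ab_group_add,finite})" and P: "CARD('b::{ab_group_add,finite}) = p ^ k"
  shows "card {e :: 'a \<times> 'b \<Rightarrow>\<^sub>0 'f. e * e = e \<and> star Q e = e} =
    2 ^ card (range (orb (\<lambda>a::'a. - nat_multiple Q a)))"
proof -
  let ?T = "{u :: 'a \<times> 'b \<Rightarrow>\<^sub>0 'f. u ^ Q = u \<and> star Q u = u}"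
  let ?\<iota> = "Poly_Mapping.single (0 :: 'a \<times> 'b) :: 'f \<Rightarrow> _"
  let ?K = "{c :: 'f. c ^ Q = c}"
  have card_K: "card ?K = Q"
    using card_subfield[OF prime \<nu> card_f] Q by simp
  have inj: "inj_on ?\<iota> ?K"
    by (rule inj_on_subset[OF inj_single subset_UNIV])
  have add: "(x + y) ^ Q = x ^ Q + y ^ Q" for x y :: "'a \<times> 'b \<Rightarrow>\<^sub>0 'f"
    by (rule freshmans_dream'[of _ \<nu>]) (simp_all add: CHAR_group_algebra prime Q)
  have diff: "(x - y) ^ Q = x ^ Q - y ^ Q" for x y :: "'a \<times> 'b \<Rightarrow>\<^sub>0 'f"
    using add[of "x - y" y] by (simp add: algebra_simps)
  have "card {e \<in> ?T. e * e = e} = 2 ^ card (range (orb (\<lambda>a::'a. - nat_multiple Q a)))"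
  proof (rule card_idempotents[where q = Q and K = "?\<iota> ` ?K"])
    show "finite ?T"
      by (rule finite_subset[OF subset_UNIV finite_poly_mapping])
    show "card (?\<iota> ` ?K) = Q"
      using inj card_K by (simp add: card_image)
    have "star Q (?\<iota> c) = ?\<iota> c" if "c ^ Q = c" for c
      using that Q_ge_2 by (intro poly_mapping_eqI) (auto simp: lookup_single when_def)
    then show "?\<iota> ` ?K \<subseteq> ?T"
      by (auto simp: single_power)
    show "c = d" if K: "c \<in> ?\<iota> ` ?K" "d \<in> ?\<iota> ` ?K" and "c * e = d * e" "e \<noteq> 0" for c d e
    proof -
      obtain c' d' where cd: "c = ?\<iota> c'" "d = ?\<iota> d'"
        using K by blast
      obtain g where "Poly_Mapping.lookup e g \<noteq> 0"
        using \<open>e \<noteq> 0\<close> by (metis lookup_zero poly_mapping_eqI)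
      moreover have "Poly_Mapping.lookup (?\<iota> x * e) g = x * Poly_Mapping.lookup e g" for x
        by (simp add: Poly_Mapping.map.rep_eq when_def flip: mult_map_scale_conv_mult)
      ultimately show ?thesis
        using \<open>c * e = d * e\<close> cd by (metis mult_right_cancel)
    qed
    show "(\<Prod>c\<in>?\<iota> ` ?K. x - c) = 0" if "x \<in> ?T" for x
    proof -
      have "(\<Prod>c\<in>?K. x - ?\<iota> c) = x ^ Q - x"
        by (rule prod_minus_subfield)
          (use card_K Q_ge_2 in \<open>auto simp: single_add mult_single\<close>)
      then show ?thesis
        using that inj by (simp add: prod.reindex)
    qed
    show "card ?T = Q ^ card (range (orb (\<lambda>a::'a. - nat_multiple Q a)))"
      by (rule card_power_Q_star_fixed[OF A P])
  qed (use Q_ge_2 in \<open>auto simp: star_1 star_diff star_mult diff power_mult_distrib\<close>)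
  \<comment> \<open>Since \<open>Q > 0\<close>, every self-conjugate idempotent already lies in
    \<open>?T\<close>.\<close>
  moreover have "e ^ n = e" if "e * e = e" "n > 0" for e :: "'a \<times> 'b \<Rightarrow>\<^sub>0 'f" and n
    using that(2,1) by (induction n rule: nat_induct_non_zero) auto
  then have "{e \<in> ?T. e * e = e} = {e. e * e = e \<and> star Q e = e}"
    using Q_ge_2 by auto
  ultimately show ?thesis
    by simp
qed

text \<open>The sign cancels in the square of the map, which is multiplication by
  \<open>p ^ (2 * \<nu>)\<close>; its orbits are therefore the cyclotomic classes, and the two kinds
  in \<open>card_orbs_square\<close> are the two types.\<close>

lemma card_orbs_eq_classes:
  assumes A: "\<not> p dvd CARD('a::{ab_group_add,finite})"
  shows "2 * card (range (orb (\<lambda>a::'a. - nat_multiple Q a))) =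
    2 * card (classes_type_I' p \<nu> :: 'a set set) + card (classes_type_II' p \<nu> :: 'a set set)"
proof -
  let ?f = "\<lambda>a::'a. - nat_multiple Q a"
  have "coprime Q CARD('a)"
    using A prime Q by (simp add: prime_imp_coprime)
  then have inj: "inj ?f"
    using inj_nat_multiple[of Q] Q_ge_2 by (simp add: inj_def)
  have "((?f ^^ 2) ^^ i) a = nat_multiple ((Q * Q) ^ i) a" for i a
    by (induction i) (simp_all add: numeral_2_eq_2 nat_multiple_mult nat_multiple_uminus)
  then have "orb (?f ^^ 2) a = cyclotomic_class (p ^ (2 * \<nu>)) a" for a
    by (simp add: orb_def cyclotomic_class_def Q mult_2 power_add)
  then show ?thesis
    using card_orbs_square[OF inj] by (simp add: classes_type_I'_def classes_type_II'_def type_I'_def Q)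
qed

end

theorem corollary5p3:
  fixes p \<nu> r_I' r_II' :: nat
  assumes "prime p"
    and "\<nu> > 0"
    and "CARD('f::{field,finite}) = p ^ (2 * \<nu>)"
    and "\<not> p dvd CARD('a::{ab_group_add,finite})"
    and "\<exists>k. CARD('b::{ab_group_add,finite}) = p ^ k"
    and "r_I' = card (classes_type_I' p \<nu> :: 'a set set)"
    and "2 * r_II' = card (classes_type_II' p \<nu> :: 'a set set)"
  shows "card {C :: ('a \<times> 'b \<Rightarrow>\<^sub>0 'f) set.
           abelian_code C \<and> hermitian_complementary_dual p \<nu> C} = 2 ^ (r_I' + r_II')"
proof -
  interpret hermitian_field p \<nu> "p ^ \<nu>" "TYPE('f)"
    by unfold_locales (use assms in auto)
  obtain k where "CARD('b) = p ^ k"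
    using assms(5) by blast
  then have "card {C :: ('a \<times> 'b \<Rightarrow>\<^sub>0 'f) set. abelian_code C \<and> hermitian_complementary_dual p \<nu> C} =
      2 ^ card (range (orb (\<lambda>a::'a. - nat_multiple (p ^ \<nu>) a)))"
    unfolding card_hermitian_complementary_dual by (rule card_star_idempotents[OF assms(4)])
  moreover have "card (range (orb (\<lambda>a::'a. - nat_multiple (p ^ \<nu>) a))) = r_I' + r_II'"
    using card_orbs_eq_classes[OF assms(4)] assms(6,7) by simp
  ultimately show ?thesis
    by simp
qed

end
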